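(* Let each of $a^{\square}$ and $b^{\diamond}$ denote either the variable itself or its complex conjugate ($a^{\square}\in\{a,a^{*}\}$, $b^{\diamond}\in\{b,b^{*}\}$). Let $\phi_1,\phi_2$ be complex-valued functions of $(a,b)$ on a domain $G\subseteq\mathbb{C}^2$, which are holomorphic in $a$ if $a^{\square}=a$ and conjugate holomorphic in $a$ if $a^{\square}=a^{*}$, and holomorphic in $b$ if $b^{\diamond}=b$ and conjugate holomorphic in $b$ if $b^{\diamond}=b^{*}$. Then: (1) $\psi=(\phi_1,\phi_2)$ satisfies the four-dimensional Laplace equation $\partial_x^2\psi+\partial_y^2\psi+\partial_z^2\psi+\partial_u^2\psi=0$ in $G$, where $a=x+iy$, $b=z+iu$. (2) If, in addition, $\phi_1,\phi_2$ satisfy in $G$ either $$\frac{\partial\phi_1}{\partial a^{\square}}=\frac{\partial\phi_2}{\partial b^{\diamond}},\quad \frac{\partial\phi_2}{\partial a^{\square}}=-\frac{\partial\phi_1}{\partial b^{\diamond}}\qquad\text{or}\qquad \frac{\partial\phi_1}{\partial a^{\square}}=-\frac{\partial\phi_2}{\partial b^{\diamond}},\quad \frac{\partial\phi_2}{\partial a^{\square}}=\frac{\partial\phi_1}{\partial b^{\diamond}},$$ then each of $\phi_1,\phi_2$ satisfies the complexified two-dimensional Laplace equation $$\frac{\partial^{2}\phi_k}{\partial (a^{\square})^{2}}+\frac{\partial^{2}\phi_k}{\partial (b^{\diamond})^{2}}=0,\qquad k=1,2.$$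
   Context: A domain is a connected open set. $^{*}$ denotes complex conjugation. A complex function of one complex variable is conjugate holomorphic if it is the complex conjugate of a holomorphic function. For a conjugate holomorphic function $f$, the derivative with respect to the conjugate variable is $\frac{df}{da^{*}}=\lim_{a'\to a}\frac{f(a')-f(a)}{a'^{*}-a^{*}}$; for functions of two variables $\partial/\partial a^{*}$ and $\partial/\partial b^{*}$ denote the corresponding partial derivatives, and $\partial/\partial a$, $\partial/\partial b$ are the usual complex partial derivatives. *)

theory Defs
  imports "HOL-Analysis.Analysis"
begin

definition conj_holomorphic_on :: "(complex \<Rightarrow> complex) \<Rightarrow> complex set \<Rightarrow> bool"
    (infixl "conj'_holomorphic'_on" 50)
  where "f conj_holomorphic_on S \<longleftrightarrow> (\<exists>g. g holomorphic_on S \<and> (\<forall>z\<in>S. f z = cnj (g z)))"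

definition conj_quotient :: "(complex \<Rightarrow> complex) \<Rightarrow> complex \<Rightarrow> complex \<Rightarrow> complex"
  where "conj_quotient f z w = (f w - f z) / (cnj w - cnj z)"

text \<open>The choice between a variable and its complex conjugate.\<close>

datatype var_kind = Plain | Conjugate

fun sq_holomorphic_on :: "var_kind \<Rightarrow> (complex \<Rightarrow> complex) \<Rightarrow> complex set \<Rightarrow> bool" where
  "sq_holomorphic_on Plain f S \<longleftrightarrow> f holomorphic_on S"
| "sq_holomorphic_on Conjugate f S \<longleftrightarrow> f conj_holomorphic_on S"

fun sq_differentiable :: "var_kind \<Rightarrow> (complex \<Rightarrow> complex) \<Rightarrow> complex \<Rightarrow> bool" where
  "sq_differentiable Plain f z \<longleftrightarrow> f field_differentiable (at z)"
| "sq_differentiable Conjugate f z \<longleftrightarrow> (\<exists>D. (conj_quotient f z \<longlongrightarrow> D) (at z))"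

fun sq_deriv :: "var_kind \<Rightarrow> (complex \<Rightarrow> complex) \<Rightarrow> complex \<Rightarrow> complex" where
  "sq_deriv Plain f z = deriv f z"
| "sq_deriv Conjugate f z = Lim (at z) (conj_quotient f z)"

text \<open>The condition on the functions is imposed in each variable separately; no joint
  regularity is assumed.\<close>

definition sq_holomorphic2_on ::
    "var_kind \<Rightarrow> var_kind \<Rightarrow> (complex \<times> complex \<Rightarrow> complex) \<Rightarrow> (complex \<times> complex) set \<Rightarrow> bool"
  where "sq_holomorphic2_on s d \<phi> G \<longleftrightarrow>
    (\<forall>b. sq_holomorphic_on s (\<lambda>a. \<phi> (a, b)) {a. (a, b) \<in> G}) \<and>
    (\<forall>a. sq_holomorphic_on d (\<lambda>b. \<phi> (a, b)) {b. (a, b) \<in> G})"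

definition differentiable_a ::
    "var_kind \<Rightarrow> (complex \<times> complex \<Rightarrow> complex) \<Rightarrow> complex \<times> complex \<Rightarrow> bool"
  where "differentiable_a s \<phi> p \<longleftrightarrow> sq_differentiable s (\<lambda>a. \<phi> (a, snd p)) (fst p)"

definition differentiable_b ::
    "var_kind \<Rightarrow> (complex \<times> complex \<Rightarrow> complex) \<Rightarrow> complex \<times> complex \<Rightarrow> bool"
  where "differentiable_b d \<phi> p \<longleftrightarrow> sq_differentiable d (\<lambda>b. \<phi> (fst p, b)) (snd p)"

definition partial_a ::
    "var_kind \<Rightarrow> (complex \<times> complex \<Rightarrow> complex) \<Rightarrow> complex \<times> complex \<Rightarrow> complex"
  where "partial_a s \<phi> p = sq_deriv s (\<lambda>a. \<phi> (a, snd p)) (fst p)"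

definition partial_b ::
    "var_kind \<Rightarrow> (complex \<times> complex \<Rightarrow> complex) \<Rightarrow> complex \<times> complex \<Rightarrow> complex"
  where "partial_b d \<phi> p = sq_deriv d (\<lambda>b. \<phi> (fst p, b)) (snd p)"

text \<open>Derivatives are total functions, so satisfying a second-order equation includes the
  existence of the derivatives that occur in it.\<close>

definition satisfies_complexified_laplace ::
    "var_kind \<Rightarrow> var_kind \<Rightarrow> (complex \<times> complex \<Rightarrow> complex) \<Rightarrow> (complex \<times> complex) set \<Rightarrow> bool"
  where "satisfies_complexified_laplace s d \<phi> G \<longleftrightarrow>
    (\<forall>p\<in>G. differentiable_a s \<phi> p \<and> differentiable_a s (partial_a s \<phi>) p \<and>
           differentiable_b d \<phi> p \<and> differentiable_b d (partial_b d \<phi>) p \<and>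
           partial_a s (partial_a s \<phi>) p + partial_b d (partial_b d \<phi>) p = 0)"

text \<open>Real partial derivatives along a direction \<open>e\<close>. With \<open>a = x + \<i> y\<close> and \<open>b = z + \<i> u\<close>, the
  coordinates \<open>x\<close>, \<open>y\<close>, \<open>z\<close>, \<open>u\<close> belong to the directions \<open>(1, 0)\<close>, \<open>(\<i>, 0)\<close>, \<open>(0, 1)\<close>,
  \<open>(0, \<i>)\<close>.\<close>

definition real_differentiable_along ::
    "'v::real_vector \<Rightarrow> ('v \<Rightarrow> 'w::real_normed_vector) \<Rightarrow> 'v \<Rightarrow> bool"
  where "real_differentiable_along e f p \<longleftrightarrow> (\<lambda>t::real. f (p + t *\<^sub>R e)) differentiable (at 0)"

definition real_partial ::
    "'v::real_vector \<Rightarrow> ('v \<Rightarrow> 'w::real_normed_vector) \<Rightarrow> 'v \<Rightarrow> 'w"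
  where "real_partial e f p = vector_derivative (\<lambda>t::real. f (p + t *\<^sub>R e)) (at 0)"

definition satisfies_laplace4 ::
    "(complex \<times> complex \<Rightarrow> 'w::real_normed_vector) \<Rightarrow> (complex \<times> complex) set \<Rightarrow> bool"
  where "satisfies_laplace4 \<psi> G \<longleftrightarrow>
    (\<forall>p\<in>G.
      (\<forall>e\<in>{(1, 0), (\<i>, 0), (0, 1), (0, \<i>)}.
         real_differentiable_along e \<psi> p \<and> real_differentiable_along e (real_partial e \<psi>) p) \<and>
      real_partial (1, 0) (real_partial (1, 0) \<psi>) p +
      real_partial (\<i>, 0) (real_partial (\<i>, 0) \<psi>) p +
      real_partial (0, 1) (real_partial (0, 1) \<psi>) p +
      real_partial (0, \<i>) (real_partial (0, \<i>) \<psi>) p = 0)"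

end

theory Submission
  imports Defs "HOL-Complex_Analysis.Complex_Analysis"
begin

text \<open>The Laplace equation in four variables holds because each complex variable contributes
  \<open>(1\<^sup>2 + (\<plusminus>\<i>)\<^sup>2) \<cdot> \<phi>'' = 0\<close>. In the second part the difficulty is that the functions are only separately
  holomorphic, so that mixed derivatives cannot be interchanged without Hartogs' theorem. The
  first-order system replaces that theorem: the combinations \<open>f = \<phi>1 \<plusminus> \<i> \<phi>2\<close> solve transport
  equations \<open>\<partial>f/\<partial>a = k \<partial>f/\<partial>b\<close> with \<open>k\<^sup>2 = -1\<close>, and \<open>f (a, b0) = f (a0, b0 + k (a - a0))\<close> near
  \<open>a0\<close>. By Baire's theorem \<open>f\<close> is bounded for \<open>b\<close> in some small disc, where Cauchy's estimates
  make the chain rule along the characteristics valid; the identity theorem in \<open>b\<close> carries the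
  equality over to the given point. Then \<open>\<partial>\<^sup>2f/\<partial>a\<^sup>2 = k\<^sup>2 \<partial>\<^sup>2f/\<partial>b\<^sup>2\<close>.\<close>

section \<open>Boundedness on a strip by Baire category\<close>

text \<open>Continuity in \<open>b\<close> makes each set \<open>E n\<close> of parameters with
  bound \<open>n\<close> closed, and compactness of \<open>K\<close> with continuity in
  \<open>a\<close> makes these sets cover the ball. By Baire one of them contains a ball, on which
  \<open>n\<close> is a uniform bound. Nothing is said about where that ball lies, so it may miss
  \<open>b0\<close>.\<close>

lemma separately_continuous_bounded_strip:
  fixes f :: "'a::metric_space \<Rightarrow> 'b::{real_normed_vector,heine_borel} \<Rightarrow> 'c::real_normed_vector"
  assumes "compact K" and "r > 0"
    and cont1: "\<And>b. b \<in> cball b0 r \<Longrightarrow> continuous_on K (\<lambda>a. f a b)"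
    and cont2: "\<And>a. a \<in> K \<Longrightarrow> continuous_on (cball b0 r) (f a)"
  obtains b1 \<rho> M where "\<rho> > 0" "ball b1 \<rho> \<subseteq> ball b0 r"
    and "\<And>a b. a \<in> K \<Longrightarrow> b \<in> ball b1 \<rho> \<Longrightarrow> norm (f a b) \<le> M"
proof -
  define S where "S = cball b0 r"
  define E where "E n = {b \<in> S. \<forall>a\<in>K. norm (f a b) \<le> real n}" for n
  have closedE: "closed (E n)" for n
  proof -
    have "E n = S \<inter> (\<Inter>a\<in>K. {b \<in> S. norm (f a b) \<le> real n})"
      by (auto simp: E_def)
    moreover have "closed {b \<in> S. norm (f a b) \<le> real n}" if "a \<in> K" for a
    proof -
      have "continuous_on S (\<lambda>b. norm (f a b))"
        using cont2[OF that] unfolding S_def by (intro continuous_intros)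
      then have "closed (S \<inter> (\<lambda>b. norm (f a b)) -` {..real n})"
        by (intro continuous_closed_preimage) (auto simp: S_def)
      then show ?thesis
        by (simp add: vimage_def Int_def)
    qed
    ultimately show ?thesis
      by (auto simp: S_def intro!: closed_Int closed_INT)
  qed
  \<comment> \<open>That is, some \<open>E n\<close> has interior relative to \<open>S\<close>.
    Otherwise all the complements \<open>S - E n\<close> are open and dense in \<open>S\<close>,
    while their intersection is empty.\<close>
  have "\<exists>n. \<not> S \<subseteq> closure (S - E n)"
  proof (rule ccontr)
    assume "\<not> ?thesis"
    then have dense: "S \<subseteq> closure (S - E n)" for n
      by blast
    have "S \<subseteq> closure (\<Inter>(range (\<lambda>n. S - E n)))"
    proof (rule Baire)
      show "closed S"
        by (simp add: S_def)
      show "openin (top_of_set S) T \<and> S \<subseteq> closure T" if T: "T \<in> range (\<lambda>n. S - E n)" for T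
      proof -
        obtain n where "T = S - E n"
          using T by blast
        moreover have "closedin (top_of_set S) (E n)"
          using closedE by (intro closed_subset) (auto simp: E_def)
        ultimately show ?thesis
          using dense by auto
      qed
    qed simp
    moreover have "\<Inter>(range (\<lambda>n. S - E n)) = {}"
    proof -
      have "\<exists>n. b \<in> E n" if "b \<in> S" for b
      proof -
        have "bounded ((\<lambda>a. f a b) ` K)"
          using that \<open>compact K\<close> cont1 by (auto simp: S_def intro!: compact_imp_bounded compact_continuous_image)
        then obtain B where B: "\<And>a. a \<in> K \<Longrightarrow> norm (f a b) \<le> B"
          by (auto simp: bounded_iff)
        obtain n where "B \<le> real n"
          using real_arch_simple by blast
        then have "b \<in> E n"
          using that B by (auto simp: E_def intro: order_trans)
        then show ?thesis ..
      qed
      then show ?thesis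
        by blast
    qed
    ultimately have "S \<subseteq> {}"
      by (simp only: closure_empty)
    then show False
      using \<open>r > 0\<close> by (simp add: S_def)
  qed
  then obtain n x where x: "x \<in> S" "x \<notin> closure (S - E n)"
    by blast
  define U where "U = ball b0 r - closure (S - E n)"
  have "open U"
    by (simp add: U_def open_Diff)
  moreover have "U \<noteq> {}"
  proof -
    \<comment> \<open>The point \<open>x\<close> may lie on the bounding sphere. An open set that
      meets the closure of the open ball also meets the ball itself, which gives a point of
      \<open>U\<close>.\<close>
    have "x \<in> closure (ball b0 r)"
      using x \<open>r > 0\<close> by (simp add: S_def)
    then have "- closure (S - E n) \<inter> ball b0 r \<noteq> {}"
      using x open_Int_closure_eq_empty[of "- closure (S - E n)" "ball b0 r"] by auto
    then show ?thesis
      by (auto simp: U_def)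
  qed
  ultimately obtain b1 \<rho> where "\<rho> > 0" and sub: "ball b1 \<rho> \<subseteq> U"
    by (metis ex_in_conv open_contains_ball)
  moreover have "U \<subseteq> E n"
    using closure_subset[of "S - E n"] ball_subset_cball[of b0 r] unfolding U_def S_def by blast
  moreover have "ball b1 \<rho> \<subseteq> ball b0 r"
    using sub by (auto simp: U_def)
  ultimately show thesis
    using that[of \<rho> b1 "real n"] unfolding E_def by blast
qed

section \<open>Differentiation along a complex line without joint regularity\<close>

text \<open>Taylor's formula of first order, with the second derivative controlled by Cauchy's
  estimate on discs of radius \<open>\<eta>\<close> centred in \<open>ball a \<eta>\<close>. What
  matters is that the constant depends on \<open>M\<close> and \<open>\<eta>\<close> only, hence is
  uniform over a bounded family of functions. The factor 2 is the \<open>fact 2\<close> of Cauchy's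
  estimate.\<close>

lemma holomorphic_linear_remainder:
  assumes holf: "f holomorphic_on ball a (2 * \<eta>)" and "\<eta> > 0"
    and bound: "\<And>x. x \<in> ball a (2 * \<eta>) \<Longrightarrow> norm (f x) \<le> M"
    and t: "norm t < \<eta>"
  shows "norm (f (a + t) - f a - t * deriv f a) \<le> 2 * M / \<eta>\<^sup>2 * norm t ^ 2"
proof -
  have "norm ((deriv ^^ 0) f (a + t) - (\<Sum>i\<le>1. (deriv ^^ i) f a * (a + t - a) ^ i / fact i))
      \<le> 2 * M / \<eta>\<^sup>2 * norm (a + t - a) ^ Suc 1 / fact 1"
  proof (rule complex_Taylor[where S = "ball a \<eta>"])
    show "((deriv ^^ i) f has_field_derivative (deriv ^^ Suc i) f x) (at x within ball a \<eta>)"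
      if "x \<in> ball a \<eta>" for i x
    proof -
      have "(deriv ^^ i) f holomorphic_on ball a (2 * \<eta>)"
        using holf by (rule holomorphic_higher_deriv) simp
      then have "((deriv ^^ i) f has_field_derivative deriv ((deriv ^^ i) f) x) (at x)"
        by (rule holomorphic_derivI) (use that \<open>\<eta> > 0\<close> in auto)
      then show ?thesis
        by (simp add: has_field_derivative_at_within)
    qed
    show "cmod ((deriv ^^ Suc 1) f x) \<le> 2 * M / \<eta>\<^sup>2" if "x \<in> ball a \<eta>" for x
    proof -
      have sub: "cball x \<eta> \<subseteq> ball a (2 * \<eta>)"
        using that by (intro cball_subset_ball_iff[THEN iffD2]) (simp add: dist_commute)
      have "norm ((deriv ^^ 2) f x) \<le> fact 2 * M / \<eta> ^ 2"
      proof (rule Cauchy_inequality)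
        show "f holomorphic_on ball x \<eta>"
          using holf by (rule holomorphic_on_subset) (use sub ball_subset_cball in blast)
        show "continuous_on (cball x \<eta>) f"
          using holomorphic_on_imp_continuous_on[OF holf] sub by (rule continuous_on_subset)
        show "norm (f y) \<le> M" if "norm (x - y) = \<eta>" for y
          using that sub by (intro bound) (auto simp: dist_norm)
      qed fact
      then show ?thesis
        by (simp add: numeral_2_eq_2)
    qed
  qed (use t \<open>\<eta> > 0\<close> in \<open>auto simp: dist_norm\<close>)
  then show ?thesis
    by (simp add: algebra_simps power2_eq_square)
qed

text \<open>Write \<open>f (a + t) (b + c * t)\<close> as
  \<open>f a (b + c * t) + t * P (b + c * t) + rem t\<close>, where \<open>P\<close> is the
  derivative in the first variable. The bound \<open>M\<close> makes the Taylor remainder in the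
  first variable uniform in the second, so \<open>rem t\<close> is of order \<open>t^2\<close>
  although its second argument moves with \<open>t\<close>.\<close>

lemma separate_chain_rule:
  fixes f :: "complex \<Rightarrow> complex \<Rightarrow> complex"
  assumes "open A" "open B" "a \<in> A" "b \<in> B"
    and hol: "\<And>y. y \<in> B \<Longrightarrow> (\<lambda>x. f x y) holomorphic_on A"
    and bound: "\<And>x y. x \<in> A \<Longrightarrow> y \<in> B \<Longrightarrow> norm (f x y) \<le> M"
    and diff: "f a field_differentiable (at b)"
    and cont: "isCont (\<lambda>y. deriv (\<lambda>x. f x y) a) b"
  shows "((\<lambda>t. f (a + t) (b + c * t)) has_field_derivative
           (deriv (\<lambda>x. f x b) a + c * deriv (f a) b)) (at 0)"
proof -
  define P where "P y = deriv (\<lambda>x. f x y) a" for y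
  define rem where "rem t = f (a + t) (b + c * t) - f a (b + c * t) - t * P (b + c * t)" for t
  obtain \<delta> where "\<delta> > 0" "ball a \<delta> \<subseteq> A"
    using \<open>open A\<close> \<open>a \<in> A\<close> open_contains_ball by blast
  define \<eta> where "\<eta> = \<delta> / 2"
  have \<eta>: "\<eta> > 0" "ball a (2 * \<eta>) \<subseteq> A"
    using \<open>\<delta> > 0\<close> \<open>ball a \<delta> \<subseteq> A\<close> by (auto simp: \<eta>_def)
  have shift: "isCont (\<lambda>t. b + c * t) 0"
    by (intro continuous_intros)
  have line_in: "\<forall>\<^sub>F t in at 0. b + c * t \<in> B"
    using shift \<open>open B\<close> \<open>b \<in> B\<close> unfolding isCont_def by (auto dest: topological_tendstoD)
  have small: "\<forall>\<^sub>F t in at 0. norm (t::complex) < \<eta>"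
    using \<eta> by (auto simp: eventually_at dist_norm)
  have "((\<lambda>t. rem t / t) \<longlongrightarrow> 0) (at 0)"
  proof (rule Lim_null_comparison)
    show "\<forall>\<^sub>F t in at 0. norm (rem t / t) \<le> 2 * M / \<eta>\<^sup>2 * norm t"
      using line_in small eventually_neq_at_within[of 0]
    proof eventually_elim
      case (elim t)
      have "norm (rem t) \<le> 2 * M / \<eta>\<^sup>2 * norm t ^ 2"
        unfolding rem_def P_def
        using \<eta> elim by (intro holomorphic_linear_remainder)
          (auto intro: bound holomorphic_on_subset[OF hol])
      then show ?case
        using elim \<eta>(1) by (simp add: norm_divide pos_divide_le_eq power2_eq_square mult.assoc)
    qed
    show "((\<lambda>t. 2 * M / \<eta>\<^sup>2 * norm t) \<longlongrightarrow> 0) (at (0::complex))"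
      by (rule tendsto_eq_intros refl | simp)+
  qed
  then have D1: "(rem has_field_derivative 0) (at 0)"
    by (simp add: DERIV_def rem_def)
  have "isCont (\<lambda>t. P (b + c * t)) 0"
    using isCont_o2[OF shift, of P] cont by (simp add: P_def[abs_def])
  \<comment> \<open>The factor \<open>t\<close> vanishes at 0, so the difference quotient is
    \<open>P (b + c * t)\<close> and continuity of \<open>P\<close> at \<open>b\<close>
    suffices.\<close>
  then have D2: "((\<lambda>t. t * P (b + c * t)) has_field_derivative P b) (at 0)"
    using LIM_equal[of 0 "\<lambda>t. t * P (b + c * t) / t" "\<lambda>t. P (b + c * t)" "P b"]
    by (simp add: DERIV_def isCont_def)
  have "(f a has_field_derivative deriv (f a) b) (at (b + c * 0))"
    using diff by (simp add: field_differentiable_derivI)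
  moreover have "((\<lambda>t. b + c * t) has_field_derivative c) (at 0)"
    by (auto intro!: derivative_eq_intros)
  ultimately have D3: "((\<lambda>t. f a (b + c * t)) has_field_derivative deriv (f a) b * c) (at 0)"
    by (rule DERIV_chain2)
  have "((\<lambda>t. rem t + t * P (b + c * t) + f a (b + c * t)) has_field_derivative
           (0 + P b + deriv (f a) b * c)) (at 0)"
    by (intro DERIV_add D1 D2 D3)
  then show ?thesis
    by (simp add: rem_def P_def mult.commute)
qed

section \<open>The transport equation\<close>

text \<open>The function is constant along the characteristics \<open>b = c - k * (z - a0)\<close>,
  because its derivative there is the \<open>a\<close>-derivative minus \<open>k\<close> times the
  \<open>b\<close>-derivative. This is first shown inside the strip over
  \<open>ball b1 \<rho>\<close>, where \<open>f\<close> is bounded, and then continued analytically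
  in \<open>b\<close> to the centre \<open>b0\<close>.\<close>

lemma transport_equation_translate:
  fixes f :: "complex \<Rightarrow> complex \<Rightarrow> complex"
  assumes "R > 0"
    and holA: "\<And>b. b \<in> ball b0 R \<Longrightarrow> (\<lambda>a. f a b) holomorphic_on ball a0 R"
    and holB: "\<And>a. a \<in> ball a0 R \<Longrightarrow> f a holomorphic_on ball b0 R"
    and transport: "\<And>a b. a \<in> ball a0 R \<Longrightarrow> b \<in> ball b0 R \<Longrightarrow>
                      deriv (\<lambda>a. f a b) a = k * deriv (f a) b"
  obtains \<epsilon> where "\<epsilon> > 0"
    and "\<And>a. a \<in> ball a0 \<epsilon> \<Longrightarrow> b0 + k * (a - a0) \<in> ball b0 R \<and> f a b0 = f a0 (b0 + k * (a - a0))"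
proof -
  define r where "r = R / 2"
  have r: "r > 0" "r < R" and subR: "cball a0 r \<subseteq> ball a0 R" "cball b0 r \<subseteq> ball b0 R"
    using \<open>R > 0\<close> by (auto simp: r_def)
  obtain b1 \<rho> M where \<rho>: "\<rho> > 0" "ball b1 \<rho> \<subseteq> ball b0 r"
    and bound: "\<And>a b. a \<in> cball a0 r \<Longrightarrow> b \<in> ball b1 \<rho> \<Longrightarrow> norm (f a b) \<le> M"
  proof (rule separately_continuous_bounded_strip[of "cball a0 r" r b0 f])
    show "continuous_on (cball a0 r) (\<lambda>a. f a b)" if "b \<in> cball b0 r" for b
      using holomorphic_on_imp_continuous_on[OF holA] subR that by (blast intro: continuous_on_subset)
    show "continuous_on (cball b0 r) (f a)" if "a \<in> cball a0 r" for a
      using holomorphic_on_imp_continuous_on[OF holB] subR that by (blast intro: continuous_on_subset)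
  qed (use r in auto)
  have subB: "ball b1 \<rho> \<subseteq> ball b0 R"
    using \<rho> subR ball_subset_cball[of b0 r] by blast
  have deriv0: "((\<lambda>z. f z (c - k * (z - a0))) has_field_derivative 0) (at z)"
    if z: "z \<in> ball a0 r" and in_strip: "c - k * (z - a0) \<in> ball b1 \<rho>" for z c
  proof -
    define b where "b = c - k * (z - a0)"
    have zR: "z \<in> ball a0 R"
      using z subR(1) ball_subset_cball[of a0 r] by blast
    have bR: "b \<in> ball b0 R"
      using in_strip subB unfolding b_def by blast
    have "((\<lambda>t. f (z + t) (b + (-k) * t)) has_field_derivative
            (deriv (\<lambda>a. f a b) z + (-k) * deriv (f z) b)) (at 0)"
    proof (rule separate_chain_rule[where A = "ball a0 r" and B = "ball b1 \<rho>"])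
      show "(\<lambda>x. f x y) holomorphic_on ball a0 r" if "y \<in> ball b1 \<rho>" for y
      proof (rule holomorphic_on_subset[OF holA])
        show "y \<in> ball b0 R"
          using that subB by blast
        show "ball a0 r \<subseteq> ball a0 R"
          using r by (simp add: subset_ball)
      qed
      show "norm (f x y) \<le> M" if "x \<in> ball a0 r" "y \<in> ball b1 \<rho>" for x y
        using bound that by simp
      show "f z field_differentiable at b"
        using holB[OF zR] bR holomorphic_on_imp_differentiable_at by blast
      \<comment> \<open>The equation itself supplies the continuity in \<open>y\<close> of the
        \<open>a\<close>-derivative: it equals \<open>k\<close> times the
        \<open>b\<close>-derivative, which is holomorphic in \<open>y\<close> for fixed
        \<open>z\<close>.\<close>
      have "(\<lambda>y. k * deriv (f z) y) holomorphic_on ball b0 R"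
        by (intro holomorphic_intros holB zR) simp
      then have "(\<lambda>y. deriv (\<lambda>x. f x y) z) holomorphic_on ball b0 R"
        by (rule holomorphic_transform) (use transport[OF zR] in simp)
      then show "isCont (\<lambda>y. deriv (\<lambda>x. f x y) z) b"
        by (rule continuous_on_interior[OF holomorphic_on_imp_continuous_on])
          (use bR in \<open>simp add: interior_open del: mem_ball\<close>)
    qed (use z in_strip in \<open>auto simp: b_def\<close>)
    moreover have "deriv (\<lambda>a. f a b) z = k * deriv (f z) b"
      using zR bR by (rule transport)
    ultimately have "((\<lambda>t. f (t + z) (b - k * t)) has_field_derivative 0) (at 0)"
      by (simp add: add.commute)
    then have "((\<lambda>t. (\<lambda>w. f w (c - k * (w - a0))) (t + z)) has_field_derivative 0) (at 0)"
      by (simp add: b_def algebra_simps)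
    then show ?thesis
      using DERIV_shift[of "\<lambda>w. f w (c - k * (w - a0))" 0 0 z] by simp
  qed
  \<comment> \<open>For \<open>a\<close> in \<open>ball a0 \<epsilon>\<close> the shift
    \<open>k * (a - a0)\<close> is shorter than \<open>\<rho> / 4\<close>, which keeps
    characteristics in the strip, and shorter than \<open>r = R / 2\<close>, which keeps shifted
    points of \<open>ball b0 r\<close> in \<open>ball b0 R\<close>. The summand 1 covers
    \<open>k = 0\<close>.\<close>
  define \<epsilon> where "\<epsilon> = min r (min (\<rho> / 4) r / (norm k + 1))"
  have kpos: "norm k + 1 > 0"
    by (simp add: add_nonneg_pos)
  have \<epsilon>: "\<epsilon> > 0" "\<epsilon> \<le> r"
    using r \<rho> kpos by (auto simp: \<epsilon>_def)
  have k\<epsilon>: "norm (k * (a - a0)) < min (\<rho> / 4) r" if "a \<in> ball a0 \<epsilon>" for a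
  proof -
    have "norm (k * (a - a0)) \<le> (norm k + 1) * norm (a - a0)"
      by (simp add: norm_mult mult_right_mono)
    also have "\<dots> < (norm k + 1) * \<epsilon>"
      using that by (intro mult_strict_left_mono) (auto simp: dist_norm norm_minus_commute kpos)
    also have "\<dots> \<le> (norm k + 1) * (min (\<rho> / 4) r / (norm k + 1))"
      by (intro mult_left_mono) (use kpos in \<open>auto simp: \<epsilon>_def\<close>)
    also have "\<dots> = min (\<rho> / 4) r"
      using kpos by simp
    finally show ?thesis .
  qed
  have near: "f a b = f a0 (b + k * (a - a0))" if a: "a \<in> ball a0 \<epsilon>" and b: "b \<in> ball b1 (\<rho> / 4)" for a b
  proof -
    \<comment> \<open>The characteristic through \<open>(a, b)\<close> meets \<open>z = a0\<close>
      at \<open>c\<close>. Over all of \<open>ball a0 \<epsilon>\<close> its distance from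
      \<open>b1\<close> is less than three times \<open>\<rho> / 4\<close>.\<close>
    define c where "c = b + k * (a - a0)"
    have strip: "c - k * (z - a0) \<in> ball b1 \<rho>" if "z \<in> ball a0 \<epsilon>" for z
    proof -
      have "norm (b1 - (c - k * (z - a0))) = norm ((b1 - b) - k * (a - a0) + k * (z - a0))"
        by (simp add: c_def algebra_simps)
      also have "\<dots> \<le> norm (b1 - b) + norm (k * (a - a0)) + norm (k * (z - a0))"
        by (rule order_trans[OF norm_triangle_ineq] add_right_mono norm_triangle_ineq4)+
      also have "\<dots> < \<rho>"
        using k\<epsilon>[OF that] k\<epsilon>[OF a] b \<rho> by (simp add: dist_norm)
      finally show ?thesis
        by (simp add: dist_norm)
    qed
    have "\<exists>C. \<forall>z\<in>ball a0 \<epsilon>. f z (c - k * (z - a0)) = C"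
      using \<epsilon> strip by (intro has_field_derivative_zero_constant has_field_derivative_at_within[OF deriv0]) auto
    then have "f a (c - k * (a - a0)) = f a0 (c - k * (a0 - a0))"
      using a \<epsilon> by (metis centre_in_ball)
    then show ?thesis
      by (simp add: c_def)
  qed
  have in_R: "b + k * (a - a0) \<in> ball b0 R" if "a \<in> ball a0 \<epsilon>" "b \<in> ball b0 r" for a b
  proof -
    have "norm (b0 - (b + k * (a - a0))) \<le> norm (b0 - b) + norm (k * (a - a0))"
      by (metis diff_diff_eq norm_triangle_ineq4)
    also have "\<dots> < R"
      using k\<epsilon>[OF that(1)] that(2) by (simp add: dist_norm r_def)
    finally show ?thesis
      by (simp add: dist_norm)
  qed
  \<comment> \<open>With \<open>a\<close> fixed, both sides are holomorphic in \<open>b\<close> on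
    \<open>ball b0 r\<close> and agree on the small disc around \<open>b1\<close>, so the identity
    theorem applies.\<close>
  have "f a b0 = f a0 (b0 + k * (a - a0))" if a: "a \<in> ball a0 \<epsilon>" for a
  proof (rule analytic_continuation_open[where s = "ball b1 (\<rho> / 4)" and s' = "ball b0 r"
        and f = "f a" and g = "\<lambda>b. f a0 (b + k * (a - a0))"])
    show "ball b1 (\<rho> / 4) \<subseteq> ball b0 r"
      using \<rho> by (intro order_trans[OF subset_ball \<rho>(2)]) simp
    show "f a holomorphic_on ball b0 r"
      using a \<epsilon> r by (intro holomorphic_on_subset[OF holB]) (auto simp: subset_ball)
    have "f a0 \<circ> (\<lambda>b. b + k * (a - a0)) holomorphic_on ball b0 r"
      using in_R[OF a] \<open>R > 0\<close>
      by (intro holomorphic_on_compose_gen[OF _ holB] holomorphic_intros) auto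
    then show "(\<lambda>b. f a0 (b + k * (a - a0))) holomorphic_on ball b0 r"
      by (simp add: o_def)
  qed (use near[OF a] r \<rho> in auto)
  with \<epsilon> in_R r show thesis
    by (intro that[of \<epsilon>]) auto
qed

text \<open>Near \<open>a0\<close> the slice \<open>f a b0\<close> is the one-variable function
  \<open>f a0\<close> composed with an affine map of slope \<open>k\<close>. Differentiating twice
  gives \<open>k^2\<close>, and no mixed derivative occurs.\<close>

lemma transport_equation_second_derivs:
  fixes f :: "complex \<Rightarrow> complex \<Rightarrow> complex"
  assumes "R > 0"
    and "\<And>b. b \<in> ball b0 R \<Longrightarrow> (\<lambda>a. f a b) holomorphic_on ball a0 R"
    and holB: "\<And>a. a \<in> ball a0 R \<Longrightarrow> f a holomorphic_on ball b0 R"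
    and "\<And>a b. a \<in> ball a0 R \<Longrightarrow> b \<in> ball b0 R \<Longrightarrow> deriv (\<lambda>a. f a b) a = k * deriv (f a) b"
  shows "deriv (deriv (\<lambda>a. f a b0)) a0 = k\<^sup>2 * deriv (deriv (f a0)) b0"
proof -
  obtain \<epsilon> where "\<epsilon> > 0"
    and \<epsilon>: "\<And>a. a \<in> ball a0 \<epsilon> \<Longrightarrow> b0 + k * (a - a0) \<in> ball b0 R \<and> f a b0 = f a0 (b0 + k * (a - a0))"
    using transport_equation_translate[of R b0 f a0 k] assms by blast
  have line: "((\<lambda>a. b0 + k * (a - a0)) has_field_derivative k) (at a)" for a
    by (auto intro!: derivative_eq_intros)
  have chain: "((\<lambda>a. h (b0 + k * (a - a0))) has_field_derivative deriv h (b0 + k * (a - a0)) * k) (at a)"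
    if "h holomorphic_on ball b0 R" "a \<in> ball a0 \<epsilon>" for h a
    using that \<epsilon> by (intro DERIV_chain2[OF _ line] holomorphic_derivI) auto
  have hol: "f a0 holomorphic_on ball b0 R"
    using \<open>R > 0\<close> by (simp add: holB)
  have first: "deriv (\<lambda>a. f a b0) a = deriv (f a0) (b0 + k * (a - a0)) * k" if "a \<in> ball a0 \<epsilon>" for a
    by (rule DERIV_imp_deriv, rule has_field_derivative_transform_within_open[OF chain[OF hol that], where S = "ball a0 \<epsilon>"])
      (use that \<epsilon> in auto)
  have "((\<lambda>a. deriv (f a0) (b0 + k * (a - a0)) * k) has_field_derivative
          deriv (deriv (f a0)) (b0 + k * (a0 - a0)) * k * k) (at a0)"
    using \<open>\<epsilon> > 0\<close> hol by (intro DERIV_cmult_right chain holomorphic_deriv) auto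
  then have "(deriv (\<lambda>a. f a b0) has_field_derivative
          deriv (deriv (f a0)) (b0 + k * (a0 - a0)) * k * k) (at a0)"
    by (rule has_field_derivative_transform_within_open[where S = "ball a0 \<epsilon>"])
      (use first \<open>\<epsilon> > 0\<close> in auto)
  from DERIV_imp_deriv[OF this] show ?thesis
    by (simp add: power2_eq_square)
qed

section \<open>The coupled first-order system\<close>

text \<open>For \<open>w * w = -1\<close> the combination \<open>F1 + w * F2\<close> solves the
  transport equation with factor \<open>- w * c\<close>, whose square is
  \<open>- c^2\<close>.\<close>

lemma rotated_transport_system_second_derivs:
  fixes F1 F2 :: "complex \<Rightarrow> complex \<Rightarrow> complex"
  assumes "R > 0"
    and hol1: "\<And>b. b \<in> ball b0 R \<Longrightarrow> (\<lambda>a. F1 a b) holomorphic_on ball a0 R"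
      "\<And>a. a \<in> ball a0 R \<Longrightarrow> F1 a holomorphic_on ball b0 R"
    and hol2: "\<And>b. b \<in> ball b0 R \<Longrightarrow> (\<lambda>a. F2 a b) holomorphic_on ball a0 R"
      "\<And>a. a \<in> ball a0 R \<Longrightarrow> F2 a holomorphic_on ball b0 R"
    and eq1: "\<And>a b. a \<in> ball a0 R \<Longrightarrow> b \<in> ball b0 R \<Longrightarrow>
               deriv (\<lambda>a. F1 a b) a = c * deriv (F2 a) b"
    and eq2: "\<And>a b. a \<in> ball a0 R \<Longrightarrow> b \<in> ball b0 R \<Longrightarrow>
               deriv (\<lambda>a. F2 a b) a = - c * deriv (F1 a) b"
  shows "deriv (deriv (\<lambda>a. F1 a b0)) a0 = - c\<^sup>2 * deriv (deriv (F1 a0)) b0"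
    and "deriv (deriv (\<lambda>a. F2 a b0)) a0 = - c\<^sup>2 * deriv (deriv (F2 a0)) b0"
proof -
  have deriv_comb: "deriv (\<lambda>z. g z + w * h z) z = deriv g z + w * deriv h z"
    if "g holomorphic_on S" "h holomorphic_on S" "open S" "z \<in> S" for g h w z S
    using that by (intro DERIV_imp_deriv DERIV_add DERIV_cmult) (auto intro: holomorphic_derivI)
  have deriv2_comb: "deriv (deriv (\<lambda>z. g z + w * h z)) z = deriv (deriv g) z + w * deriv (deriv h) z"
    if "g holomorphic_on S" "h holomorphic_on S" "open S" "z \<in> S" for g h w z S
  proof -
    have "\<forall>\<^sub>F x in nhds z. deriv (\<lambda>z. g z + w * h z) x = deriv g x + w * deriv h x"
      using deriv_comb that by (auto simp: eventually_nhds)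
    then have "deriv (deriv (\<lambda>z. g z + w * h z)) z = deriv (\<lambda>x. deriv g x + w * deriv h x) z"
      by (rule deriv_cong_ev) simp
    also have "\<dots> = deriv (deriv g) z + w * deriv (deriv h) z"
      using that by (intro deriv_comb[of _ S] holomorphic_deriv)
    finally show ?thesis .
  qed
  \<comment> \<open>For \<open>w\<close> with \<open>w\<^sup>2 = -1\<close>, the combination \<open>F1 + w * F2\<close> diagonalizes the system.\<close>
  have comb: "deriv (deriv (\<lambda>a. F1 a b0)) a0 + w * deriv (deriv (\<lambda>a. F2 a b0)) a0
      = - c\<^sup>2 * (deriv (deriv (F1 a0)) b0 + w * deriv (deriv (F2 a0)) b0)"
    if w: "w * w = -1" for w
  proof -
    define f where "f a b = F1 a b + w * F2 a b" for a b
    have "deriv (deriv (\<lambda>a. f a b0)) a0 = (- w * c)\<^sup>2 * deriv (deriv (f a0)) b0"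
    proof (rule transport_equation_second_derivs)
      fix a b assume a: "a \<in> ball a0 R" and b: "b \<in> ball b0 R"
      have "deriv (\<lambda>a. f a b) a = deriv (\<lambda>a. F1 a b) a + w * deriv (\<lambda>a. F2 a b) a"
        unfolding f_def using a b by (intro deriv_comb[of _ "ball a0 R"] hol1 hol2) auto
      also have "\<dots> = c * deriv (F2 a) b - w * c * deriv (F1 a) b"
        using a b by (simp add: eq1 eq2)
      also have "\<dots> = - w * c * (deriv (F1 a) b + w * deriv (F2 a) b)"
        using w by (simp add: algebra_simps flip: mult.assoc[of w w])
      also have "deriv (F1 a) b + w * deriv (F2 a) b = deriv (f a) b"
        unfolding f_def[abs_def] using a b by (intro deriv_comb[of _ "ball b0 R", symmetric] hol1 hol2) auto
      finally show "deriv (\<lambda>a. f a b) a = - w * c * deriv (f a) b" .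
    qed (use \<open>R > 0\<close> in \<open>auto simp: f_def[abs_def] intro!: holomorphic_intros hol1 hol2\<close>)
    moreover have "deriv (deriv (\<lambda>a. f a b0)) a0
        = deriv (deriv (\<lambda>a. F1 a b0)) a0 + w * deriv (deriv (\<lambda>a. F2 a b0)) a0"
      unfolding f_def using \<open>R > 0\<close> by (intro deriv2_comb[of _ "ball a0 R"] hol1 hol2) auto
    moreover have "deriv (deriv (f a0)) b0 = deriv (deriv (F1 a0)) b0 + w * deriv (deriv (F2 a0)) b0"
      unfolding f_def[abs_def] using \<open>R > 0\<close> by (intro deriv2_comb[of _ "ball b0 R"] hol1 hol2) auto
    moreover have "(- w * c)\<^sup>2 = w * w * c\<^sup>2"
      by (simp add: power2_eq_square)
    ultimately show ?thesis
      by (simp add: w)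
  qed
  \<comment> \<open>The derivatives are complex, so one value of \<open>w\<close> does not separate
    \<open>F1\<close> from \<open>F2\<close>; the identities for \<open>\<i>\<close> and
    \<open>-\<i>\<close> together do.\<close>
  have "deriv (deriv (\<lambda>a. F1 a b0)) a0 + \<i> * deriv (deriv (\<lambda>a. F2 a b0)) a0
      = - c\<^sup>2 * (deriv (deriv (F1 a0)) b0 + \<i> * deriv (deriv (F2 a0)) b0)"
    "deriv (deriv (\<lambda>a. F1 a b0)) a0 + (-\<i>) * deriv (deriv (\<lambda>a. F2 a b0)) a0
      = - c\<^sup>2 * (deriv (deriv (F1 a0)) b0 + (-\<i>) * deriv (deriv (F2 a0)) b0)"
    by (rule comb; simp)+
  then show "deriv (deriv (\<lambda>a. F1 a b0)) a0 = - c\<^sup>2 * deriv (deriv (F1 a0)) b0"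
    and "deriv (deriv (\<lambda>a. F2 a b0)) a0 = - c\<^sup>2 * deriv (deriv (F2 a0)) b0"
    by (simp_all add: complex_eq_iff algebra_simps)
qed

section \<open>Reduction of conjugate variables to plain ones\<close>

text \<open>Precomposition with this involution turns both kinds of holomorphy, and both
  derivatives, into the ordinary ones, so that the four combinations of kinds need no separate
  treatment.\<close>

fun sq_var :: "var_kind \<Rightarrow> complex \<Rightarrow> complex" where
  "sq_var Plain z = z"
| "sq_var Conjugate z = cnj z"

lemma sq_var_involution [simp]: "sq_var s (sq_var s z) = z"
  by (cases s) auto

lemma sq_var_add_scaleR: "sq_var s (z + t *\<^sub>R e) = sq_var s z + t *\<^sub>R sq_var s e"
  by (cases s) auto

lemma continuous_on_sq_var [continuous_intros]:
  "continuous_on S f \<Longrightarrow> continuous_on S (\<lambda>x. sq_var s (f x))"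
  by (cases s) (auto intro!: continuous_intros)

lemma open_sq_var_vimage:
  assumes "open S"
  shows "open {w. sq_var s w \<in> S}"
  using open_vimage[OF assms, of "sq_var s"] continuous_on_sq_var[OF continuous_on_id, of UNIV s]
  by (simp add: vimage_def)

text \<open>If \<open>f\<close> is the conjugate of \<open>g\<close>, then \<open>f\<close> after
  \<open>cnj\<close> is \<open>g\<close> conjugated on both sides, and this double conjugation
  preserves holomorphy in either direction.\<close>

lemma sq_holomorphic_on_iff:
  assumes "open S"
  shows "sq_holomorphic_on s f S \<longleftrightarrow> (\<lambda>w. f (sq_var s w)) holomorphic_on {w. sq_var s w \<in> S}"
proof (cases s)
  case Conjugate
  define A where "A = {w. cnj w \<in> S}"
  have A: "cnj ` A = S" "cnj ` S = A" "open A"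
    using open_sq_var_vimage[OF assms, of Conjugate] by (auto simp: A_def image_cnj_conv_vimage_cnj)
  have "f conj_holomorphic_on S \<longleftrightarrow> (\<lambda>w. f (cnj w)) holomorphic_on A"
  proof
    assume "f conj_holomorphic_on S"
    then obtain g where g: "g holomorphic_on S" "\<And>z. z \<in> S \<Longrightarrow> f z = cnj (g z)"
      by (auto simp: conj_holomorphic_on_def)
    have "cnj \<circ> g \<circ> cnj holomorphic_on A"
      using g A by (intro holomorphic_on_compose_cnj_cnj) auto
    then show "(\<lambda>w. f (cnj w)) holomorphic_on A"
      by (rule holomorphic_transform) (simp add: A_def g)
  next
    assume "(\<lambda>w. f (cnj w)) holomorphic_on A"
    then have "cnj \<circ> (\<lambda>w. f (cnj w)) \<circ> cnj holomorphic_on S"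
      using A assms by (intro holomorphic_on_compose_cnj_cnj) auto
    then show "f conj_holomorphic_on S"
      unfolding conj_holomorphic_on_def by (intro exI conjI) auto
  qed
  then show ?thesis
    by (simp add: Conjugate A_def)
qed simp

text \<open>In the conjugate case the substitution of \<open>cnj w\<close> for \<open>w\<close>
  carries the ordinary difference quotient at \<open>cnj z\<close> to
  \<open>conj_quotient f z\<close>.\<close>

lemma sq_deriv_eqI:
  assumes "((\<lambda>w. f (sq_var s w)) has_field_derivative D) (at (sq_var s z))"
  shows "sq_differentiable s f z" and "sq_deriv s f z = D"
proof -
  have "sq_differentiable s f z \<and> sq_deriv s f z = D"
  proof (cases s)
    case Plain
    then show ?thesis
      using assms by (auto simp: field_differentiable_def intro: DERIV_imp_deriv)
  next
    case Conjugate
    have "((\<lambda>w. (f (cnj w) - f z) / (w - cnj z)) \<longlongrightarrow> D) (at (cnj z))"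
      using assms by (simp add: Conjugate has_field_derivative_iff)
    moreover have "filterlim cnj (at (cnj z)) (at z)"
      by (intro filterlim_atI tendsto_intros) (auto simp: eventually_at_filter)
    ultimately have "((\<lambda>w. (f (cnj (cnj w)) - f z) / (cnj w - cnj z)) \<longlongrightarrow> D) (at z)"
      by (rule filterlim_compose)
    then have "(conj_quotient f z \<longlongrightarrow> D) (at z)"
      by (simp add: conj_quotient_def[abs_def])
    then show ?thesis
      by (auto simp: Conjugate intro: tendsto_Lim)
  qed
  then show "sq_differentiable s f z" and "sq_deriv s f z = D"
    by auto
qed

context
  fixes s :: var_kind and f :: "complex \<Rightarrow> complex" and S :: "complex set"
  assumes "open S" and hol: "sq_holomorphic_on s f S"
begin

lemma has_field_derivative_sq_deriv:
  assumes "z \<in> S"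
  shows "((\<lambda>w. f (sq_var s w)) has_field_derivative sq_deriv s f z) (at (sq_var s z))"
proof -
  have "((\<lambda>w. f (sq_var s w)) has_field_derivative deriv (\<lambda>w. f (sq_var s w)) (sq_var s z)) (at (sq_var s z))"
    using hol \<open>open S\<close> assms
    by (intro holomorphic_derivI[of _ "{w. sq_var s w \<in> S}"] open_sq_var_vimage)
      (auto simp: sq_holomorphic_on_iff)
  then show ?thesis
    using sq_deriv_eqI(2) by metis
qed

lemma sq_holomorphic_on_imp_sq_differentiable: "z \<in> S \<Longrightarrow> sq_differentiable s f z"
  by (rule sq_deriv_eqI(1)[OF has_field_derivative_sq_deriv])

lemma sq_deriv_eq_deriv: "sq_var s w \<in> S \<Longrightarrow> sq_deriv s f (sq_var s w) = deriv (\<lambda>w. f (sq_var s w)) w"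
  using DERIV_imp_deriv[OF has_field_derivative_sq_deriv, of "sq_var s w"] by simp

lemma sq_holomorphic_on_sq_deriv: "sq_holomorphic_on s (sq_deriv s f) S"
proof -
  have "deriv (\<lambda>w. f (sq_var s w)) holomorphic_on {w. sq_var s w \<in> S}"
    using hol \<open>open S\<close> by (intro holomorphic_deriv open_sq_var_vimage) (simp_all add: sq_holomorphic_on_iff)
  then have "(\<lambda>w. sq_deriv s f (sq_var s w)) holomorphic_on {w. sq_var s w \<in> S}"
    by (rule holomorphic_transform) (simp add: sq_deriv_eq_deriv)
  then show ?thesis
    by (simp add: sq_holomorphic_on_iff \<open>open S\<close>)
qed

text \<open>\<open>sq_var\<close> maps the real line through \<open>z\<close> in direction
  \<open>e\<close> to the line through \<open>sq_var s z\<close> in direction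
  \<open>sq_var s e\<close>; the chain rule produces that direction as a factor.\<close>

lemma has_vector_derivative_sq_deriv:
  assumes "z \<in> S"
  shows "((\<lambda>t. f (z + t *\<^sub>R e)) has_vector_derivative sq_var s e * sq_deriv s f z) (at 0)"
proof -
  have "((\<lambda>t. sq_var s z + t *\<^sub>R sq_var s e) has_vector_derivative sq_var s e) (at 0)"
    by (auto intro!: derivative_eq_intros)
  then have "((\<lambda>w. f (sq_var s w)) \<circ> (\<lambda>t. sq_var s z + t *\<^sub>R sq_var s e)
      has_vector_derivative sq_var s e * sq_deriv s f z) (at 0)"
    by (rule field_vector_diff_chain_at) (simp add: has_field_derivative_sq_deriv assms)
  then show ?thesis
    by (simp add: o_def flip: sq_var_add_scaleR)
qed

end

lemma sq_deriv_sq_deriv_eq_deriv: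
  assumes "open S" "sq_holomorphic_on s f S" "sq_var s w \<in> S"
  shows "sq_deriv s (sq_deriv s f) (sq_var s w) = deriv (deriv (\<lambda>w. f (sq_var s w))) w"
proof -
  have "sq_deriv s (sq_deriv s f) (sq_var s w) = deriv (\<lambda>w. sq_deriv s f (sq_var s w)) w"
    using assms by (intro sq_deriv_eq_deriv[OF _ sq_holomorphic_on_sq_deriv])
  also have "\<dots> = deriv (deriv (\<lambda>w. f (sq_var s w))) w"
  proof (rule deriv_cong_ev)
    have "\<forall>\<^sub>F w in nhds w. w \<in> {w. sq_var s w \<in> S}"
      using assms by (intro eventually_nhds_in_open open_sq_var_vimage) auto
    then show "\<forall>\<^sub>F w in nhds w. sq_deriv s f (sq_var s w) = deriv (\<lambda>w. f (sq_var s w)) w"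
      by eventually_elim (use assms in \<open>simp add: sq_deriv_eq_deriv\<close>)
  qed simp
  finally show ?thesis .
qed

section \<open>Slices and real directional derivatives\<close>

lemma open_slices:
  assumes "open G"
  shows "open {a. (a, b) \<in> G}" and "open {b. (a, b) \<in> G}"
proof -
  have "open ((\<lambda>a. (a, b)) -` G)" "open ((\<lambda>b. (a, b)) -` G)"
    using assms by (rule open_vimage, intro continuous_intros)+
  then show "open {a. (a, b) \<in> G}" and "open {b. (a, b) \<in> G}"
    by (simp_all add: vimage_def)
qed

text \<open>The outer derivative sees the inner one at nearby points of the line. Since
  \<open>G\<close> is open, these points lie in \<open>G\<close> for small \<open>t\<close>, where
  \<open>real_partial e f\<close> may be replaced by \<open>D1\<close>.\<close>

lemma real_partial_twiceI:
  fixes f :: "'v::real_normed_vector \<Rightarrow> 'w::real_normed_vector"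
  assumes "open G" "p \<in> G"
    and D1: "\<And>q. q \<in> G \<Longrightarrow> ((\<lambda>t. f (q + t *\<^sub>R e)) has_vector_derivative D1 q) (at 0)"
    and D2: "((\<lambda>t. D1 (p + t *\<^sub>R e)) has_vector_derivative D2) (at 0)"
  shows "real_differentiable_along e f p" "real_differentiable_along e (real_partial e f) p"
    and "real_partial e (real_partial e f) p = D2"
proof -
  have eq: "real_partial e f q = D1 q" if "q \<in> G" for q
    unfolding real_partial_def using D1[OF that] by (rule vector_derivative_at)
  define T where "T = {t. p + t *\<^sub>R e \<in> G}"
  have "open ((\<lambda>t. p + t *\<^sub>R e) -` G)"
    using \<open>open G\<close> by (rule open_vimage) (intro continuous_intros)
  then have "open T"
    by (simp add: T_def vimage_def)
  then have "((\<lambda>t. real_partial e f (p + t *\<^sub>R e)) has_vector_derivative D2) (at 0)"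
    by (rule has_vector_derivative_transform_within_open[OF D2]) (auto simp: T_def eq \<open>p \<in> G\<close>)
  then show "real_differentiable_along e (real_partial e f) p"
    and "real_partial e (real_partial e f) p = D2"
    by (auto simp: real_differentiable_along_def real_partial_def[of e "real_partial e f"]
        intro: differentiableI_vector vector_derivative_at)
  show "real_differentiable_along e f p"
    using D1[OF \<open>p \<in> G\<close>] by (auto simp: real_differentiable_along_def intro: differentiableI_vector)
qed

lemma sq_holomorphic_on_slices:
  assumes "sq_holomorphic2_on s d \<phi> G"
  shows "sq_holomorphic_on s (\<lambda>a. \<phi> (a, b)) {a. (a, b) \<in> G}"
    and "sq_holomorphic_on d (\<lambda>b. \<phi> (a, b)) {b. (a, b) \<in> G}"
  using assms by (auto simp: sq_holomorphic2_on_def)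

lemma partial_slices:
  "(\<lambda>a. partial_a s \<phi> (a, b)) = sq_deriv s (\<lambda>a. \<phi> (a, b))"
  "(\<lambda>b. partial_b d \<phi> (a, b)) = sq_deriv d (\<lambda>b. \<phi> (a, b))"
  by (auto simp: partial_a_def partial_b_def)

context
  fixes s d :: var_kind and \<phi> :: "complex \<times> complex \<Rightarrow> complex"
    and G :: "(complex \<times> complex) set" and p :: "complex \<times> complex"
  assumes "open G" and hol: "sq_holomorphic2_on s d \<phi> G" and "p \<in> G"
begin

lemma sq_holomorphic2_on_differentiable:
  "differentiable_a s \<phi> p" "differentiable_a s (partial_a s \<phi>) p"
  "differentiable_b d \<phi> p" "differentiable_b d (partial_b d \<phi>) p"
proof -
  have "fst p \<in> {a. (a, snd p) \<in> G}" "snd p \<in> {b. (fst p, b) \<in> G}"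
    using \<open>p \<in> G\<close> by simp_all
  note diff = sq_holomorphic_on_imp_sq_differentiable[OF open_slices(1)[OF \<open>open G\<close>] _ this(1)]
    sq_holomorphic_on_imp_sq_differentiable[OF open_slices(2)[OF \<open>open G\<close>] _ this(2)]
  note hol' = sq_holomorphic_on_slices[OF hol]
    sq_holomorphic_on_sq_deriv[OF open_slices(1)[OF \<open>open G\<close>] sq_holomorphic_on_slices(1)[OF hol]]
    sq_holomorphic_on_sq_deriv[OF open_slices(2)[OF \<open>open G\<close>] sq_holomorphic_on_slices(2)[OF hol]]
  show "differentiable_a s \<phi> p" "differentiable_a s (partial_a s \<phi>) p"
    "differentiable_b d \<phi> p" "differentiable_b d (partial_b d \<phi>) p"
    unfolding differentiable_a_def differentiable_b_def partial_slices
    by (rule diff hol')+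
qed

text \<open>The two facts are shaped as the premises of \<open>real_partial_twiceI\<close>: the
  function differentiated in the second is the derivative found in the first, with its factor
  \<open>sq_var s e\<close>.\<close>

lemma has_vector_derivative_partial_a:
  "((\<lambda>t. \<phi> (p + t *\<^sub>R (e, 0))) has_vector_derivative sq_var s e * partial_a s \<phi> p) (at 0)"
  "((\<lambda>t. sq_var s e * partial_a s \<phi> (p + t *\<^sub>R (e, 0))) has_vector_derivative
     (sq_var s e)\<^sup>2 * partial_a s (partial_a s \<phi>) p) (at 0)"
proof -
  obtain a b where p: "p = (a, b)"
    by (cases p)
  have a: "a \<in> {a. (a, b) \<in> G}"
    using \<open>p \<in> G\<close> p by simp
  note hvd = has_vector_derivative_sq_deriv[OF open_slices(1)[OF \<open>open G\<close>] _ a]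
  show "((\<lambda>t. \<phi> (p + t *\<^sub>R (e, 0))) has_vector_derivative sq_var s e * partial_a s \<phi> p) (at 0)"
    using hvd[OF sq_holomorphic_on_slices(1)[OF hol]] by (simp add: p partial_a_def)
  have "((\<lambda>t. sq_deriv s (\<lambda>a. \<phi> (a, b)) (a + t *\<^sub>R e)) has_vector_derivative
      sq_var s e * sq_deriv s (sq_deriv s (\<lambda>a. \<phi> (a, b))) a) (at 0)"
    by (intro hvd sq_holomorphic_on_sq_deriv sq_holomorphic_on_slices[OF hol] open_slices \<open>open G\<close>)
  from has_vector_derivative_mult_right[OF this, of "sq_var s e"]
  show "((\<lambda>t. sq_var s e * partial_a s \<phi> (p + t *\<^sub>R (e, 0))) has_vector_derivative
     (sq_var s e)\<^sup>2 * partial_a s (partial_a s \<phi>) p) (at 0)"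
    by (simp add: p partial_a_def power2_eq_square mult.assoc)
qed

lemma has_vector_derivative_partial_b:
  "((\<lambda>t. \<phi> (p + t *\<^sub>R (0, e))) has_vector_derivative sq_var d e * partial_b d \<phi> p) (at 0)"
  "((\<lambda>t. sq_var d e * partial_b d \<phi> (p + t *\<^sub>R (0, e))) has_vector_derivative
     (sq_var d e)\<^sup>2 * partial_b d (partial_b d \<phi>) p) (at 0)"
proof -
  obtain a b where p: "p = (a, b)"
    by (cases p)
  have b: "b \<in> {b. (a, b) \<in> G}"
    using \<open>p \<in> G\<close> p by simp
  note hvd = has_vector_derivative_sq_deriv[OF open_slices(2)[OF \<open>open G\<close>] _ b]
  show "((\<lambda>t. \<phi> (p + t *\<^sub>R (0, e))) has_vector_derivative sq_var d e * partial_b d \<phi> p) (at 0)"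
    using hvd[OF sq_holomorphic_on_slices(2)[OF hol]] by (simp add: p partial_b_def)
  have "((\<lambda>t. sq_deriv d (\<lambda>b. \<phi> (a, b)) (b + t *\<^sub>R e)) has_vector_derivative
      sq_var d e * sq_deriv d (sq_deriv d (\<lambda>b. \<phi> (a, b))) b) (at 0)"
    by (intro hvd sq_holomorphic_on_sq_deriv sq_holomorphic_on_slices[OF hol] open_slices \<open>open G\<close>)
  from has_vector_derivative_mult_right[OF this, of "sq_var d e"]
  show "((\<lambda>t. sq_var d e * partial_b d \<phi> (p + t *\<^sub>R (0, e))) has_vector_derivative
     (sq_var d e)\<^sup>2 * partial_b d (partial_b d \<phi>) p) (at 0)"
    by (simp add: p partial_b_def power2_eq_square mult.assoc)
qed

end

section \<open>The two Laplace equations\<close>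

lemma satisfies_laplace4_sq_holomorphic2:
  assumes G: "open G" and hol: "sq_holomorphic2_on s d \<phi>1 G" "sq_holomorphic2_on s d \<phi>2 G"
  shows "satisfies_laplace4 (\<lambda>p. (\<phi>1 p, \<phi>2 p)) G"
  unfolding satisfies_laplace4_def
proof (intro ballI)
  fix p assume "p \<in> G"
  let ?\<psi> = "\<lambda>p. (\<phi>1 p, \<phi>2 p)"
  note twice_a = real_partial_twiceI[OF G \<open>p \<in> G\<close>
      has_vector_derivative_Pair[OF has_vector_derivative_partial_a(1)[OF G hol(1)]
        has_vector_derivative_partial_a(1)[OF G hol(2)]]
      has_vector_derivative_Pair[OF has_vector_derivative_partial_a(2)[OF G hol(1) \<open>p \<in> G\<close>]
        has_vector_derivative_partial_a(2)[OF G hol(2) \<open>p \<in> G\<close>]]]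
  note twice_b = real_partial_twiceI[OF G \<open>p \<in> G\<close>
      has_vector_derivative_Pair[OF has_vector_derivative_partial_b(1)[OF G hol(1)]
        has_vector_derivative_partial_b(1)[OF G hol(2)]]
      has_vector_derivative_Pair[OF has_vector_derivative_partial_b(2)[OF G hol(1) \<open>p \<in> G\<close>]
        has_vector_derivative_partial_b(2)[OF G hol(2) \<open>p \<in> G\<close>]]]
  \<comment> \<open>Squaring removes the sign by which the two kinds differ, so the directions 1 and
    \<open>\<i>\<close> cancel in each variable for either kind.\<close>
  have sq: "(sq_var k 1)\<^sup>2 = 1" "(sq_var k \<i>)\<^sup>2 = -1" for k
    by (cases k; simp)+
  show "(\<forall>e\<in>{(1, 0), (\<i>, 0), (0, 1), (0, \<i>)}.
         real_differentiable_along e ?\<psi> p \<and> real_differentiable_along e (real_partial e ?\<psi>) p) \<and>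
      real_partial (1, 0) (real_partial (1, 0) ?\<psi>) p +
      real_partial (\<i>, 0) (real_partial (\<i>, 0) ?\<psi>) p +
      real_partial (0, 1) (real_partial (0, 1) ?\<psi>) p +
      real_partial (0, \<i>) (real_partial (0, \<i>) ?\<psi>) p = 0"
    by (simp add: twice_a twice_b sq zero_prod_def)
qed

text \<open>The constant \<open>c\<close> merges the two alternative systems, as
  \<open>c = 1\<close> and \<open>c = -1\<close>. In the coordinates given by \<open>sq_var\<close>
  the system becomes one between ordinary separately holomorphic functions on a bidisc around the
  point.\<close>

lemma satisfies_complexified_laplace_of_system:
  assumes G: "open G" and hol: "sq_holomorphic2_on s d \<phi>1 G" "sq_holomorphic2_on s d \<phi>2 G"
    and c: "c\<^sup>2 = 1"
    and eq1: "\<And>p. p \<in> G \<Longrightarrow> partial_a s \<phi>1 p = c * partial_b d \<phi>2 p"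
    and eq2: "\<And>p. p \<in> G \<Longrightarrow> partial_a s \<phi>2 p = - c * partial_b d \<phi>1 p"
  shows "satisfies_complexified_laplace s d \<phi>1 G \<and> satisfies_complexified_laplace s d \<phi>2 G"
proof -
  have "partial_a s (partial_a s \<phi>1) p + partial_b d (partial_b d \<phi>1) p = 0 \<and>
        partial_a s (partial_a s \<phi>2) p + partial_b d (partial_b d \<phi>2) p = 0" if "p \<in> G" for p
  proof -
    define a0 where "a0 = sq_var s (fst p)"
    define b0 where "b0 = sq_var d (snd p)"
    define G' where "G' = {(a, b). (sq_var s a, sq_var d b) \<in> G}"
    have p: "p = (sq_var s a0, sq_var d b0)"
      by (simp add: a0_def b0_def)
    have "open ((\<lambda>q. (sq_var s (fst q), sq_var d (snd q))) -` G)"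
      using G by (rule open_vimage) (intro continuous_intros)
    then have "open G'"
      by (simp add: G'_def vimage_def case_prod_unfold)
    moreover have "(a0, b0) \<in> G'"
      using \<open>p \<in> G\<close> by (simp add: G'_def flip: p)
    ultimately obtain A B where AB: "open A" "open B" "a0 \<in> A" "b0 \<in> B" "A \<times> B \<subseteq> G'"
      by (metis open_prod_elim mem_Sigma_iff)
    obtain ra where ra: "ra > 0" "ball a0 ra \<subseteq> A"
      using AB open_contains_ball by blast
    obtain rb where rb: "rb > 0" "ball b0 rb \<subseteq> B"
      using AB open_contains_ball by blast
    \<comment> \<open>The lemmas on the transport system use one common radius for both
      variables.\<close>
    define R where "R = min ra rb"
    have "R > 0"
      using ra rb by (simp add: R_def)
    have in_G: "(sq_var s a, sq_var d b) \<in> G" if "a \<in> ball a0 R" "b \<in> ball b0 R" for a b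
    proof -
      have "a \<in> A" "b \<in> B"
        using that ra(2) rb(2) by (auto simp: R_def)
      then show ?thesis
        using AB(5) by (auto simp: G'_def)
    qed
    have lift_a: "(\<lambda>a. \<phi> (sq_var s a, sq_var d b)) holomorphic_on ball a0 R"
      if "sq_holomorphic2_on s d \<phi> G" "b \<in> ball b0 R" for \<phi> b
    proof (rule holomorphic_on_subset)
      show "(\<lambda>a. \<phi> (sq_var s a, sq_var d b)) holomorphic_on {a. sq_var s a \<in> {a. (a, sq_var d b) \<in> G}}"
        using sq_holomorphic_on_slices(1)[OF that(1)] open_slices(1)[OF G]
        by (simp only: sq_holomorphic_on_iff)
    qed (use in_G that in auto)
    have lift_b: "(\<lambda>b. \<phi> (sq_var s a, sq_var d b)) holomorphic_on ball b0 R"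
      if "sq_holomorphic2_on s d \<phi> G" "a \<in> ball a0 R" for \<phi> a
    proof (rule holomorphic_on_subset)
      show "(\<lambda>b. \<phi> (sq_var s a, sq_var d b)) holomorphic_on {b. sq_var d b \<in> {b. (sq_var s a, b) \<in> G}}"
        using sq_holomorphic_on_slices(2)[OF that(1)] open_slices(2)[OF G]
        by (simp only: sq_holomorphic_on_iff)
    qed (use in_G that in auto)
    have deriv_a: "partial_a s \<phi> (sq_var s a, sq_var d b) = deriv (\<lambda>a. \<phi> (sq_var s a, sq_var d b)) a"
      and deriv_b: "partial_b d \<phi> (sq_var s a, sq_var d b) = deriv (\<lambda>b. \<phi> (sq_var s a, sq_var d b)) b"
      if "sq_holomorphic2_on s d \<phi> G" "a \<in> ball a0 R" "b \<in> ball b0 R" for \<phi> a b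
      using in_G[OF that(2,3)]
        sq_deriv_eq_deriv[OF open_slices(1)[OF G] sq_holomorphic_on_slices(1)[OF that(1)]]
        sq_deriv_eq_deriv[OF open_slices(2)[OF G] sq_holomorphic_on_slices(2)[OF that(1)]]
      by (simp_all add: partial_a_def partial_b_def)
    have deriv2: "partial_a s (partial_a s \<phi>) p = deriv (deriv (\<lambda>a. \<phi> (sq_var s a, sq_var d b0))) a0"
      "partial_b d (partial_b d \<phi>) p = deriv (deriv (\<lambda>b. \<phi> (sq_var s a0, sq_var d b))) b0"
      if "sq_holomorphic2_on s d \<phi> G" for \<phi>
      using \<open>p \<in> G\<close>
        sq_deriv_sq_deriv_eq_deriv[OF open_slices(1)[OF G] sq_holomorphic_on_slices(1)[OF that]]
        sq_deriv_sq_deriv_eq_deriv[OF open_slices(2)[OF G] sq_holomorphic_on_slices(2)[OF that]]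
      by (simp_all add: p partial_a_def partial_b_def partial_slices)
    let ?F1 = "\<lambda>a b. \<phi>1 (sq_var s a, sq_var d b)" and ?F2 = "\<lambda>a b. \<phi>2 (sq_var s a, sq_var d b)"
    have sys: "deriv (\<lambda>a. ?F1 a b) a = c * deriv (?F2 a) b" "deriv (\<lambda>a. ?F2 a b) a = - c * deriv (?F1 a) b"
      if "a \<in> ball a0 R" "b \<in> ball b0 R" for a b
      using eq1[OF in_G[OF that]] eq2[OF in_G[OF that]]
      by (simp_all add: deriv_a[OF _ that] deriv_b[OF _ that] hol)
    \<comment> \<open>Here \<open>c^2 = 1\<close> turns the factor \<open>- c^2\<close> into
      \<open>-1\<close>, which is the complexified Laplace equation at \<open>p\<close>.\<close>
    show ?thesis
      using rotated_transport_system_second_derivs[of R b0 ?F1 a0 ?F2 c, OF \<open>R > 0\<close>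
          lift_a[OF hol(1)] lift_b[OF hol(1)] lift_a[OF hol(2)] lift_b[OF hol(2)] sys]
      by (simp add: deriv2 hol c)
  qed
  then show ?thesis
    using sq_holomorphic2_on_differentiable[OF G] hol
    unfolding satisfies_complexified_laplace_def by blast
qed

theorem mainTheorem11:
  fixes s d :: var_kind
    and \<phi>1 \<phi>2 :: "complex \<times> complex \<Rightarrow> complex"
    and G :: "(complex \<times> complex) set"
  assumes "open G" and "connected G"
    and "sq_holomorphic2_on s d \<phi>1 G" and "sq_holomorphic2_on s d \<phi>2 G"
  shows "satisfies_laplace4 (\<lambda>p. (\<phi>1 p, \<phi>2 p)) G \<and>
    ((\<forall>p\<in>G. partial_a s \<phi>1 p = partial_b d \<phi>2 p \<and> partial_a s \<phi>2 p = - partial_b d \<phi>1 p) \<or>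
     (\<forall>p\<in>G. partial_a s \<phi>1 p = - partial_b d \<phi>2 p \<and> partial_a s \<phi>2 p = partial_b d \<phi>1 p)
     \<longrightarrow> satisfies_complexified_laplace s d \<phi>1 G \<and> satisfies_complexified_laplace s d \<phi>2 G)"
proof (intro conjI impI)
  show "satisfies_laplace4 (\<lambda>p. (\<phi>1 p, \<phi>2 p)) G"
    using assms by (intro satisfies_laplace4_sq_holomorphic2)
next
  assume "(\<forall>p\<in>G. partial_a s \<phi>1 p = partial_b d \<phi>2 p \<and> partial_a s \<phi>2 p = - partial_b d \<phi>1 p) \<or>
     (\<forall>p\<in>G. partial_a s \<phi>1 p = - partial_b d \<phi>2 p \<and> partial_a s \<phi>2 p = partial_b d \<phi>1 p)"
  then have "satisfies_complexified_laplace s d \<phi>1 G \<and> satisfies_complexified_laplace s d \<phi>2 G"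
  proof
    assume "\<forall>p\<in>G. partial_a s \<phi>1 p = partial_b d \<phi>2 p \<and> partial_a s \<phi>2 p = - partial_b d \<phi>1 p"
    then show ?thesis
      using assms by (intro satisfies_complexified_laplace_of_system[where c = 1]) auto
  next
    assume "\<forall>p\<in>G. partial_a s \<phi>1 p = - partial_b d \<phi>2 p \<and> partial_a s \<phi>2 p = partial_b d \<phi>1 p"
    then show ?thesis
      using assms by (intro satisfies_complexified_laplace_of_system[where c = "-1"]) auto
  qed
  then show "satisfies_complexified_laplace s d \<phi>1 G" "satisfies_complexified_laplace s d \<phi>2 G"
    by auto
qed

end
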